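(* Let $F$ be the free monoid on symbols $\pi_1,\pi_2$ and let $T$ be the set of $F$-colored binary trees, with its magma operation $\Sigma$ and its product $(A,B)\mapsto AB$. Then $(T,\Sigma,\pi_1,\pi_2)$ is a CQP monoid. Moreover, if $(N,\Sigma',\pi_1',\pi_2')$ is another CQP monoid, then there is a unique CQP monoid homomorphism $\phi:T\to N$.
   Context: A CQP (categorical quasiproduct) monoid $(M,\Sigma,\pi_1,\pi_2)$ is a monoid $M$ with elements $\pi_1,\pi_2\in M$ and a function $\Sigma:M^2\to M$ such that for all $a,b,c\in M$: $\pi_1\Sigma(a,b)=a$, $\pi_2\Sigma(a,b)=b$, and $\Sigma(ac,bc)=\Sigma(a,b)c$. A CQP monoid homomorphism $(M,\Sigma,\pi_1,\pi_2)\to(N,\Phi,\tau_1,\tau_2)$ is a monoid homomorphism $f$ (so $f(1)=1$) with $f(\pi_i)=\tau_i$ for $i=1,2$ and $f(\Sigma(a,b))=\Phi(f(a),f(b))$ for all $a,b$. $T$ is the set of finite nonempty ordered binary trees (each non-leaf vertex has exactly one left child and one right child) whose leaves are colored by elements of $F$; equivalently, $T$ is the free magma with basis $F$. $\Sigma(A,B)$ is the tree whose root has left subtree $A$ and right subtree $B$. Elements of $F$ are identified with the one-vertex trees, and each $A\in T$ is either in $F$ or uniquely $A=\Sigma(A_1,A_2)$. $F$ acts on the set $T$ from the left: $\pi_i$ sends $w\in F$ to the word $\pi_iw$, and sends $\Sigma(A_1,A_2)$ to $A_i$; a word acts by applying its symbols one at a time from right to left. The product $AB$ of $A,B\in T$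 is the tree obtained from $A$ by replacing each leaf of color $w\in F$ by the tree $wB$. The identity for this product is $1\in F$. *)

theory Defs
  imports "HOL-Algebra.Group"
begin

record 'a cqp = "'a monoid" +
  pairing :: "'a \<Rightarrow> 'a \<Rightarrow> 'a"
  proj1 :: 'a
  proj2 :: 'a

locale cqp_monoid = monoid M for M :: "('a, 'b) cqp_scheme" (structure) +
  assumes pairing_closed: "\<lbrakk>a \<in> carrier M; b \<in> carrier M\<rbrakk> \<Longrightarrow> pairing M a b \<in> carrier M"
    and proj1_closed: "proj1 M \<in> carrier M"
    and proj2_closed: "proj2 M \<in> carrier M"
    and proj1_pairing: "\<lbrakk>a \<in> carrier M; b \<in> carrier M\<rbrakk> \<Longrightarrow> proj1 M \<otimes> pairing M a b = a"
    and proj2_pairing: "\<lbrakk>a \<in> carrier M; b \<in> carrier M\<rbrakk> \<Longrightarrow> proj2 M \<otimes> pairing M a b = b"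
    and pairing_mult: "\<lbrakk>a \<in> carrier M; b \<in> carrier M; c \<in> carrier M\<rbrakk> \<Longrightarrow>
      pairing M (a \<otimes> c) (b \<otimes> c) = pairing M a b \<otimes> c"

(* The library's hom does not require the identity to be preserved. *)
definition cqp_hom :: "('a, 'c) cqp_scheme \<Rightarrow> ('b, 'd) cqp_scheme \<Rightarrow> ('a \<Rightarrow> 'b) set" where
  "cqp_hom M N = {f \<in> hom M N.
      f \<one>\<^bsub>M\<^esub> = \<one>\<^bsub>N\<^esub> \<and>
      f (proj1 M) = proj1 N \<and> f (proj2 M) = proj2 N \<and>
      (\<forall>a\<in>carrier M. \<forall>b\<in>carrier M. f (pairing M a b) = pairing N (f a) (f b))}"

datatype proj_sym = Pi1 | Pi2

(* The free monoid F: lists under concatenation, written left to right, with identity []. *)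
type_synonym proj_word = "proj_sym list"

datatype 'c leaf_tree = Leaf 'c | Node "'c leaf_tree" "'c leaf_tree"

type_synonym word_tree = "proj_word leaf_tree"

fun sym_act :: "proj_sym \<Rightarrow> word_tree \<Rightarrow> word_tree" where
  "sym_act s (Leaf w) = Leaf (s # w)"
| "sym_act Pi1 (Node A B) = A"
| "sym_act Pi2 (Node A B) = B"

(* foldr applies the rightmost symbol of the word first. *)
definition word_act :: "proj_word \<Rightarrow> word_tree \<Rightarrow> word_tree" where
  "word_act w A = foldr sym_act w A"

primrec tree_mult :: "word_tree \<Rightarrow> word_tree \<Rightarrow> word_tree" where
  "tree_mult (Leaf w) B = word_act w B"
| "tree_mult (Node A1 A2) B = Node (tree_mult A1 B) (tree_mult A2 B)"

definition tree_cqp :: "word_tree cqp" where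
  "tree_cqp = \<lparr>carrier = UNIV, mult = tree_mult, one = Leaf [],
     pairing = Node, proj1 = Leaf [Pi1], proj2 = Leaf [Pi2]\<rparr>"

end

theory Submission
  imports Defs
begin

text \<open>
  The product of trees is substitution: every leaf \<open>w\<close> of the left factor becomes the result of
  letting \<open>w\<close> act on the right factor. The monoid laws therefore reduce to one fact about the
  action, \<open>sym_act_tree_mult\<close>: a projection applied to \<open>A B\<close> only touches the factor \<open>A\<close>. Indeed,
  at a node of \<open>A\<close> it selects a subtree, before or after the substitution alike, and at a leaf
  \<open>w\<close> it lengthens the word that is waiting to act on \<open>B\<close>. Iterating over the symbols of a word
  and then inducting over the left factor gives associativity; the laws for the pairing hold by
  computation.

  For initiality, every tree is built by the pairing from words, and every word is a product of
  the projections, so a homomorphism can only be the evaluation \<open>tree_value\<close>. That evaluation is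
  multiplicative for the same reason that substitution is well behaved: the laws
  \<open>\<pi>\<^sub>1 \<Sigma>(a,b) = a\<close> and \<open>\<pi>\<^sub>2 \<Sigma>(a,b) = b\<close> say that evaluation turns the action of words on trees into
  multiplication (\<open>tree_value_word_act\<close>), which settles products with a leaf on the left, and the
  law \<open>\<Sigma>(a c, b c) = \<Sigma>(a,b) c\<close> carries this through the nodes of the left factor.
\<close>

lemma word_act_Nil [simp]: "word_act [] A = A"
  by (simp add: word_act_def)

lemma word_act_Cons [simp]: "word_act (s # w) A = sym_act s (word_act w A)"
  by (simp add: word_act_def)

lemma word_act_Leaf [simp]: "word_act w (Leaf v) = Leaf (w @ v)"
  by (induction w) simp_all

text \<open>A projection meeting a leaf of the left factor is not lost: it is recorded in the word there,
  and the substitution performs it later. Hence acting and substituting commute.\<close>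

lemma sym_act_tree_mult: "tree_mult (sym_act s A) B = sym_act s (tree_mult A B)"
  by (cases "(s, A)" rule: sym_act.cases) simp_all

lemma word_act_tree_mult: "tree_mult (word_act w A) B = word_act w (tree_mult A B)"
  by (induction w) (simp_all add: sym_act_tree_mult)

lemma tree_mult_assoc: "tree_mult (tree_mult A B) C = tree_mult A (tree_mult B C)"
  by (induction A) (simp_all add: word_act_tree_mult)

lemma tree_mult_one_right: "tree_mult A (Leaf []) = A"
  by (induction A) simp_all

lemma tree_cqp_simps [simp]:
  "carrier tree_cqp = UNIV" "mult tree_cqp = tree_mult" "one tree_cqp = Leaf []"
  "pairing tree_cqp = Node" "proj1 tree_cqp = Leaf [Pi1]" "proj2 tree_cqp = Leaf [Pi2]"
  by (simp_all add: tree_cqp_def)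

lemma cqp_monoid_tree_cqp: "cqp_monoid tree_cqp"
  by unfold_locales (simp_all add: tree_mult_assoc tree_mult_one_right)

context cqp_monoid
begin

primrec sym_value :: "proj_sym \<Rightarrow> 'a" where
  "sym_value Pi1 = proj1 M"
| "sym_value Pi2 = proj2 M"

primrec word_value :: "proj_word \<Rightarrow> 'a" where
  "word_value [] = \<one>"
| "word_value (s # w) = sym_value s \<otimes> word_value w"

primrec tree_value :: "word_tree \<Rightarrow> 'a" where
  "tree_value (Leaf w) = word_value w"
| "tree_value (Node A B) = pairing M (tree_value A) (tree_value B)"

lemma sym_value_closed [simp]: "sym_value s \<in> carrier M"
  by (cases s) (simp_all add: proj1_closed proj2_closed)

lemma word_value_closed [simp]: "word_value w \<in> carrier M"
  by (induction w) simp_all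

lemma tree_value_closed [simp]: "tree_value A \<in> carrier M"
  by (induction A) (simp_all add: pairing_closed)

text \<open>At a node this is the law \<open>\<pi>\<^sub>i \<Sigma>(a\<^sub>1,a\<^sub>2) = a\<^sub>i\<close>, which is what makes the
  combinatorial action on trees compatible with multiplication by projections.\<close>

lemma tree_value_sym_act: "tree_value (sym_act s A) = sym_value s \<otimes> tree_value A"
  by (cases "(s, A)" rule: sym_act.cases) (simp_all add: proj1_pairing proj2_pairing)

lemma tree_value_word_act: "tree_value (word_act w A) = word_value w \<otimes> tree_value A"
  by (induction w) (simp_all add: tree_value_sym_act m_assoc)

lemma tree_value_tree_mult: "tree_value (tree_mult A B) = tree_value A \<otimes> tree_value B"
  by (induction A) (simp_all add: tree_value_word_act pairing_mult)

lemma tree_value_in_cqp_hom: "tree_value \<in> cqp_hom tree_cqp M"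
  by (simp add: cqp_hom_def hom_def tree_value_tree_mult proj1_closed proj2_closed)

text \<open>The leaf \<open>s # w\<close> is the product of the one-symbol leaf \<open>[s]\<close> and the leaf \<open>w\<close>, so the values
  of a homomorphism at the two projections determine it on all leaves, and preservation of the
  pairing determines it on the remaining trees.\<close>

lemma cqp_hom_tree_cqp_unique:
  assumes "f \<in> cqp_hom tree_cqp M"
  shows "f = tree_value"
proof
  have mult: "f (tree_mult A B) = f A \<otimes> f B" for A B
    using assms by (simp add: cqp_hom_def hom_def)
  have sym: "f (Leaf [s]) = sym_value s" for s
    using assms by (cases s) (simp_all add: cqp_hom_def)
  have leaf: "f (Leaf w) = word_value w" for w
  proof (induction w)
    case Nil
    then show ?case using assms by (simp add: cqp_hom_def)
  next
    case (Cons s w)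
    then show ?case using mult[of "Leaf [s]" "Leaf w"] by (simp add: sym)
  qed
  show "f A = tree_value A" for A
    using assms by (induction A) (simp_all add: leaf cqp_hom_def)
qed

end

theorem theorem1:
  shows "cqp_monoid tree_cqp \<and>
    (\<forall>N :: ('n, 'm) cqp_scheme. cqp_monoid N \<longrightarrow> (\<exists>!\<phi>. \<phi> \<in> cqp_hom tree_cqp N))"
  using cqp_monoid_tree_cqp cqp_monoid.tree_value_in_cqp_hom
    cqp_monoid.cqp_hom_tree_cqp_unique by blast

end
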